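(* (Eisenhart's formula.) Let $(x,n):\Sigma\to\mathbb{R}^3\times S^2$ be Guichard with associate net $\check{x}$ and edge-labelling $m_{ij}$. On each edge $ij$, the line segments from $x_i$ to $x_j$ and from $\check{x}_i$ to $\check{x}_j$ are parallel, with directed lengths $d_{ij},\check{d}_{ij}$ (that is, $x_j-x_i=d_{ij}u$ and $\check x_j-\check x_i=\check d_{ij}u$ for a common unit vector $u$). Let $r_{ij},\check r_{ij}\in\mathbb{R}^\times$ be given by $\mathrm{d}x_{ji}+r_{ij}\mathrm{d}n_{ji}=0$ and $\mathrm{d}\check x_{ji}+\check r_{ij}\mathrm{d}n_{ji}=0$. Then $$d_{ij}\check{d}_{ij}\Bigl(1+\frac{1}{r_{ij}\check{r}_{ij}}\Bigr)=-\frac{2}{m_{ij}}.$$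
   Context: Domain: $\Sigma\subset\mathbb{Z}^N$; an edge $ij$ is a pair of points of $\Sigma$ differing by a standard unit vector; a quadrilateral is an elementary square with all four vertices $i,j,k,\ell$ (in cyclic order) in $\Sigma$. A vector-valued $1$-form $\alpha$ assigns $\alpha_{ji}=-\alpha_{ij}$ to each oriented edge from $i$ to $j$. $\mathrm{d}x_{ji}=x_j-x_i$. For vector-valued $1$-forms, $(\alpha\curlywedge\beta)_{\ell kji}=\tfrac14\bigl((\alpha_{ji}+\alpha_{k\ell})\wedge(\beta_{\ell i}+\beta_{kj})-(\alpha_{\ell i}+\alpha_{kj})\wedge(\beta_{ji}+\beta_{k\ell})\bigr)$. $(x,n)$ is a principal net if on each edge there is $\kappa_{ij}\in\mathbb{R}^\times$ with $\kappa_{ij}x_i+n_i=\kappa_{ij}x_j+n_j$; $r_{ij}=1/\kappa_{ij}$ is the radius of the $2$-sphere in oriented contact with $(x_i,n_i)$ and $(x_j,n_j)$. A principal net $(x,n)$ is Guichard if there is $\check x:\Sigma\to\mathbb{R}^3$, edge-parallel to $x$ ($\mathrm{d}\check x_{ij}\parallel\mathrm{d}x_{ij}$ on each edge), with $\mathrm{d}\check x\curlywedge\mathrm{d}x+\mathrm{d}n\curlywedge\mathrm{d}n=0$; $\check x$ is an associate net of $x$. Then $(\check x,n)$ is again a principal (Guichard) net, and $\check r_{ij}$ is the corresponding radius for $(\check x,n)$. The edge-labelling: in $\mathbb{R}^{4,2}$ (form $(\cdot,\cdot)$ of signature $(4,2)$) fix $\mathfrak{p}$ with $(\mathfrak{p},\mathfrak{p})=-1$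 and null $\mathfrak{o},\mathfrak{q}\perp\mathfrak{p}$ with $(\mathfrak{o},\mathfrak{q})=-1$, so $\langle\mathfrak{o},\mathfrak{q}\rangle^\perp=\mathbb{R}^3\oplus\langle\mathfrak{p}\rangle$ with $\mathbb{R}^3$ Euclidean. The Legendre lift of $(x,n)$ is $f=\langle y,\mathfrak{t}\rangle$ with $y=\mathfrak{o}+x+\tfrac12(x,x)\mathfrak{q}$ and $\mathfrak{t}=n+\mathfrak{p}+(x,n)\mathfrak{q}$. Put $f_{ij}=f_i+f_j$, $s_{ij}=f_i\cap f_j$; it is assumed regular: $\dim f_{ij}=3$ on each edge and $s_{ij}\wedge s_{jk}\wedge s_{k\ell}\wedge s_{\ell i}\neq\{0\}$ on each quadrilateral. The Legendre lift is an $\Omega$-net via the closed $\Lambda^2\mathbb{R}^{4,2}$-valued $1$-form $$\eta_{ji}=\bigl(\mathrm{d}\check x_{ji}+(\tfrac12(x_i+x_j),\mathrm{d}\check x_{ji})\mathfrak{q}\bigr)\wedge\tfrac12(y_i+y_j)+\bigl(\mathrm{d}n_{ji}+(\tfrac12(x_i+x_j),\mathrm{d}n_{ji})\mathfrak{q}\bigr)\wedge\tfrac12(\mathfrak{t}_i+\mathfrak{t}_j)\in\Lambda^2f_{ij};$$ as for every $\Omega$-net it is assumed non-degenerate: $\eta_{ij}\wedge s_{ij}\ne\{0\}$ on each edge, i.e. $\mathrm{d}\check x_{ji}\neq\kappa_{ij}\mathrm{d}n_{ji}$. For each edge choose $\sigma_i\in f_i$, $\sigma_j\in f_j$ with $\eta_{ji}=\sigma_j\wedge\sigma_i$;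 then $m_{ij}:=1/(\sigma_i,\sigma_j)\in\mathbb{R}^\times\cup\{\infty\}$ ($2/m_{ij}$ read as $0$ if $m_{ij}=\infty$). *)

theory Defs
  imports "HOL-Analysis.Analysis"
begin

section \<open>Exterior algebra\<close>

text \<open>
  The exterior algebra of the coordinate space is modelled in its standard basis: the component
  at \<open>{a\<^sub>1 < \<dots> < a\<^sub>k}\<close> is the coefficient of \<open>e\<^bsub>a\<^sub>1\<^esub> \<and> \<dots> \<and> e\<^bsub>a\<^sub>k\<^esub>\<close>. For disjoint \<open>A\<close>, \<open>B\<close> the product of the
  basis elements indexed by \<open>A\<close> and \<open>B\<close> is the one indexed by \<open>A \<union> B\<close>, up to the sign of the
  permutation that sorts \<open>A\<close> followed by \<open>B\<close>.
\<close>

definition shuffle_sign :: "'n::linorder set \<Rightarrow> 'n set \<Rightarrow> real" where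
  "shuffle_sign A B = (- 1) ^ card {(a, b). a \<in> A \<and> b \<in> B \<and> b < a}"

definition wedge :: "real ^ ('n::{finite,linorder} set) \<Rightarrow> real ^ ('n set) \<Rightarrow> real ^ ('n set)"
    (infixl "\<^bold>\<and>" 70) where
  "\<alpha> \<^bold>\<and> \<beta> = (\<chi> C. \<Sum>A\<in>Pow C. shuffle_sign A (C - A) * \<alpha> $ A * \<beta> $ (C - A))"

definition ext_vec :: "real ^ 'n::finite \<Rightarrow> real ^ ('n set)" where
  "ext_vec v = (\<chi> A. if is_singleton A then v $ the_elem A else 0)"

definition wedge_space ::
    "(real ^ ('n::{finite,linorder} set)) set \<Rightarrow> (real ^ ('n set)) set \<Rightarrow> (real ^ ('n set)) set" where
  "wedge_space U V = span {u \<^bold>\<and> v | u v. u \<in> U \<and> v \<in> V}"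

section \<open>Nets on the integer lattice\<close>

definition edge :: "(int ^ 'N::finite) set \<Rightarrow> int ^ 'N \<Rightarrow> int ^ 'N \<Rightarrow> bool" where
  "edge \<Sigma> i j \<longleftrightarrow> i \<in> \<Sigma> \<and> j \<in> \<Sigma> \<and> (\<exists>a. j = i + axis a 1 \<or> i = j + axis a 1)"

definition quadrilateral ::
    "(int ^ 'N::finite) set \<Rightarrow> int ^ 'N \<Rightarrow> int ^ 'N \<Rightarrow> int ^ 'N \<Rightarrow> int ^ 'N \<Rightarrow> bool" where
  "quadrilateral \<Sigma> i j k l \<longleftrightarrow>
     i \<in> \<Sigma> \<and> j \<in> \<Sigma> \<and> k \<in> \<Sigma> \<and> l \<in> \<Sigma> \<and>
     (\<exists>a b s t. a \<noteq> b \<and> \<bar>s\<bar> = 1 \<and> \<bar>t\<bar> = 1 \<and>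
        j = i + axis a s \<and> l = i + axis b t \<and> k = i + axis a s + axis b t)"

text \<open>A 1-form \<open>\<alpha>\<close> is a function of the end point and the start point of an
  oriented edge, in this order: \<open>\<alpha> j i\<close> is \<open>\<alpha>\<^sub>j\<^sub>i\<close>, for the edge from \<open>i\<close> to \<open>j\<close>.\<close>

definition diff_form :: "('p \<Rightarrow> 'v::real_vector) \<Rightarrow> 'p \<Rightarrow> 'p \<Rightarrow> 'v" where
  "diff_form x j i = x j - x i"

definition curlywedge ::
    "('p \<Rightarrow> 'p \<Rightarrow> real ^ 'n::{finite,linorder}) \<Rightarrow>
     ('p \<Rightarrow> 'p \<Rightarrow> real ^ 'n::{finite,linorder}) \<Rightarrow>
     'p \<Rightarrow> 'p \<Rightarrow> 'p \<Rightarrow> 'p \<Rightarrow> real ^ ('n set)" where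
  "curlywedge \<alpha> \<beta> l k j i = (1/4) *\<^sub>R
     (ext_vec (\<alpha> j i + \<alpha> k l) \<^bold>\<and> ext_vec (\<beta> l i + \<beta> k j) -
      ext_vec (\<alpha> l i + \<alpha> k j) \<^bold>\<and> ext_vec (\<beta> j i + \<beta> k l))"

definition principal_net ::
    "(int ^ 'N::finite) set \<Rightarrow> (int ^ 'N \<Rightarrow> real ^ 3) \<Rightarrow> (int ^ 'N \<Rightarrow> real ^ 3) \<Rightarrow> bool" where
  "principal_net \<Sigma> x n \<longleftrightarrow>
     (\<forall>i\<in>\<Sigma>. n i \<in> sphere 0 1) \<and>
     (\<forall>i j. edge \<Sigma> i j \<longrightarrow> (\<exists>\<kappa>. \<kappa> \<noteq> 0 \<and> \<kappa> *\<^sub>R x i + n i = \<kappa> *\<^sub>R x j + n j))"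

text \<open>Two vectors are parallel if they are linearly dependent; a zero vector is
  parallel to everything.\<close>

definition edge_parallel ::
    "(int ^ 'N::finite) set \<Rightarrow> (int ^ 'N \<Rightarrow> real ^ 3) \<Rightarrow> (int ^ 'N \<Rightarrow> real ^ 3) \<Rightarrow> bool" where
  "edge_parallel \<Sigma> x' x \<longleftrightarrow>
     (\<forall>i j. edge \<Sigma> i j \<longrightarrow> collinear {0, diff_form x' j i, diff_form x j i})"

definition associate_net ::
    "(int ^ 'N::finite) set \<Rightarrow> (int ^ 'N \<Rightarrow> real ^ 3) \<Rightarrow> (int ^ 'N \<Rightarrow> real ^ 3) \<Rightarrow>
     (int ^ 'N \<Rightarrow> real ^ 3) \<Rightarrow> bool" where
  "associate_net \<Sigma> x n x' \<longleftrightarrow>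
     edge_parallel \<Sigma> x' x \<and>
     (\<forall>i j k l. quadrilateral \<Sigma> i j k l \<longrightarrow>
        curlywedge (diff_form x') (diff_form x) l k j i +
        curlywedge (diff_form n) (diff_form n) l k j i = 0)"

definition guichard_net ::
    "(int ^ 'N::finite) set \<Rightarrow> (int ^ 'N \<Rightarrow> real ^ 3) \<Rightarrow> (int ^ 'N \<Rightarrow> real ^ 3) \<Rightarrow> bool" where
  "guichard_net \<Sigma> x n \<longleftrightarrow> principal_net \<Sigma> x n \<and> (\<exists>x'. associate_net \<Sigma> x n x')"

section \<open>The Legendre lift\<close>

text \<open>In the index type \<open>6\<close> the numeral \<open>6\<close> denotes the element \<open>0\<close>, so that
  \<open>1, \<dots>, 6\<close> are all its elements.\<close>

definition form42 :: "real ^ 6 \<Rightarrow> real ^ 6 \<Rightarrow> real" where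
  "form42 v w = v $ 1 * w $ 1 + v $ 2 * w $ 2 + v $ 3 * w $ 3 + v $ 4 * w $ 4
                - v $ 5 * w $ 5 - v $ 6 * w $ 6"

text \<open>\<open>E\<close> is an isometric identification of Euclidean 3-space with the
  orthogonal complement of \<open>\<oo>\<close>, \<open>\<qq>\<close> and \<open>\<pp>\<close>.\<close>

definition lie_frame :: "real ^ 6 \<Rightarrow> real ^ 6 \<Rightarrow> real ^ 6 \<Rightarrow> (real ^ 3 \<Rightarrow> real ^ 6) \<Rightarrow> bool" where
  "lie_frame \<pp> \<oo> \<qq> E \<longleftrightarrow>
     form42 \<pp> \<pp> = - 1 \<and> form42 \<oo> \<oo> = 0 \<and> form42 \<qq> \<qq> = 0 \<and>
     form42 \<oo> \<pp> = 0 \<and> form42 \<qq> \<pp> = 0 \<and> form42 \<oo> \<qq> = - 1 \<and>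
     linear E \<and> (\<forall>u v. form42 (E u) (E v) = u \<bullet> v) \<and>
     (\<forall>u. form42 (E u) \<pp> = 0 \<and> form42 (E u) \<oo> = 0 \<and> form42 (E u) \<qq> = 0)"

definition point_lift ::
    "real ^ 6 \<Rightarrow> real ^ 6 \<Rightarrow> (real ^ 3 \<Rightarrow> real ^ 6) \<Rightarrow> ('p \<Rightarrow> real ^ 3) \<Rightarrow> 'p \<Rightarrow> real ^ 6" where
  "point_lift \<oo> \<qq> E x i = \<oo> + E (x i) + ((1/2) * (x i \<bullet> x i)) *\<^sub>R \<qq>"

definition plane_lift ::
    "real ^ 6 \<Rightarrow> real ^ 6 \<Rightarrow> (real ^ 3 \<Rightarrow> real ^ 6) \<Rightarrow> ('p \<Rightarrow> real ^ 3) \<Rightarrow> ('p \<Rightarrow> real ^ 3) \<Rightarrow>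
     'p \<Rightarrow> real ^ 6" where
  "plane_lift \<pp> \<qq> E x n i = E (n i) + \<pp> + (x i \<bullet> n i) *\<^sub>R \<qq>"

definition legendre_lift ::
    "real ^ 6 \<Rightarrow> real ^ 6 \<Rightarrow> real ^ 6 \<Rightarrow> (real ^ 3 \<Rightarrow> real ^ 6) \<Rightarrow>
     ('p \<Rightarrow> real ^ 3) \<Rightarrow> ('p \<Rightarrow> real ^ 3) \<Rightarrow> 'p \<Rightarrow> (real ^ 6) set" where
  "legendre_lift \<pp> \<oo> \<qq> E x n i = span {point_lift \<oo> \<qq> E x i, plane_lift \<pp> \<qq> E x n i}"

definition edge_span :: "('p \<Rightarrow> (real ^ 6) set) \<Rightarrow> 'p \<Rightarrow> 'p \<Rightarrow> (real ^ 6) set" where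
  "edge_span f i j = {u + v | u v. u \<in> f i \<and> v \<in> f j}"

definition curv_sphere :: "('p \<Rightarrow> (real ^ 6) set) \<Rightarrow> 'p \<Rightarrow> 'p \<Rightarrow> (real ^ 6) set" where
  "curv_sphere f i j = f i \<inter> f j"

definition regular_lift ::
    "(int ^ 'N::finite) set \<Rightarrow> (int ^ 'N \<Rightarrow> (real ^ 6) set) \<Rightarrow> bool" where
  "regular_lift \<Sigma> f \<longleftrightarrow>
     (\<forall>i j. edge \<Sigma> i j \<longrightarrow> dim (edge_span f i j) = 3) \<and>
     (\<forall>i j k l. quadrilateral \<Sigma> i j k l \<longrightarrow>
        wedge_space (wedge_space (wedge_space
          (ext_vec ` curv_sphere f i j) (ext_vec ` curv_sphere f j k))
          (ext_vec ` curv_sphere f k l)) (ext_vec ` curv_sphere f l i) \<noteq> {0})"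

definition omega_form ::
    "real ^ 6 \<Rightarrow> real ^ 6 \<Rightarrow> real ^ 6 \<Rightarrow> (real ^ 3 \<Rightarrow> real ^ 6) \<Rightarrow>
     ('p \<Rightarrow> real ^ 3) \<Rightarrow> ('p \<Rightarrow> real ^ 3) \<Rightarrow> ('p \<Rightarrow> real ^ 3) \<Rightarrow> 'p \<Rightarrow> 'p \<Rightarrow> real ^ (6 set)" where
  "omega_form \<pp> \<oo> \<qq> E x n x' j i =
     ext_vec (E (diff_form x' j i) + (((1/2) *\<^sub>R (x i + x j)) \<bullet> diff_form x' j i) *\<^sub>R \<qq>) \<^bold>\<and>
     ext_vec ((1/2) *\<^sub>R (point_lift \<oo> \<qq> E x i + point_lift \<oo> \<qq> E x j)) +
     ext_vec (E (diff_form n j i) + (((1/2) *\<^sub>R (x i + x j)) \<bullet> diff_form n j i) *\<^sub>R \<qq>) \<^bold>\<and>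
     ext_vec ((1/2) *\<^sub>R (plane_lift \<pp> \<qq> E x n i + plane_lift \<pp> \<qq> E x n j))"

definition nondegenerate_form ::
    "(int ^ 'N::finite) set \<Rightarrow> (int ^ 'N \<Rightarrow> (real ^ 6) set) \<Rightarrow>
     (int ^ 'N \<Rightarrow> int ^ 'N \<Rightarrow> real ^ (6 set)) \<Rightarrow> bool" where
  "nondegenerate_form \<Sigma> f \<eta> \<longleftrightarrow>
     (\<forall>i j. edge \<Sigma> i j \<longrightarrow> {\<eta> i j \<^bold>\<and> ext_vec v | v. v \<in> curv_sphere f i j} \<noteq> {0})"

text \<open>The label takes values in the nonzero reals or \<open>\<infinity>\<close>; in \<^typ>\<open>ereal\<close>,
  \<open>1 / 0 = \<infinity>\<close> and \<open>2 / \<infinity> = 0\<close>, and \<open>-\<infinity>\<close> does not occur.\<close>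

definition edge_labelling ::
    "(int ^ 'N::finite) set \<Rightarrow> (int ^ 'N \<Rightarrow> (real ^ 6) set) \<Rightarrow>
     (int ^ 'N \<Rightarrow> int ^ 'N \<Rightarrow> real ^ (6 set)) \<Rightarrow> (int ^ 'N \<Rightarrow> int ^ 'N \<Rightarrow> ereal) \<Rightarrow> bool" where
  "edge_labelling \<Sigma> f \<eta> m \<longleftrightarrow>
     (\<forall>i j. edge \<Sigma> i j \<longrightarrow>
        (\<exists>\<sigma>\<^sub>i\<in>f i. \<exists>\<sigma>\<^sub>j\<in>f j. \<eta> j i = ext_vec \<sigma>\<^sub>j \<^bold>\<and> ext_vec \<sigma>\<^sub>i \<and>
           m i j = 1 / ereal (form42 \<sigma>\<^sub>i \<sigma>\<^sub>j)))"

end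

theory Submission
  imports Defs
begin

text \<open>
  Write \<open>y\<close>, \<open>\<tt>\<close> for the lifts at the end points of an edge, \<open>f\<^sub>i = \<langle>y\<^sub>i, \<tt>\<^sub>i\<rangle>\<close>, and \<open>w = y\<^sub>j - y\<^sub>i\<close>. Since
  \<open>n\<close> has unit length, the equation \<open>dx + r dn = 0\<close> lifts to the common curvature sphere
  \<open>y\<^sub>i + r \<tt>\<^sub>i = y\<^sub>j + r \<tt>\<^sub>j\<close>, that is \<open>\<tt>\<^sub>j - \<tt>\<^sub>i = - w / r\<close>. All differences of lifts along the edge are
  therefore multiples of \<open>w\<close>, the \<open>w \<and> w\<close> contributions of the midpoints drop out, and the form collapses
  to a decomposable one,
  \<open>\<eta>\<^sub>j\<^sub>i = w \<and> c\<close> with \<open>c = (r'/r) y\<^sub>i - (1/r) \<tt>\<^sub>i \<in> f\<^sub>i\<close>.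

  If also \<open>\<eta>\<^sub>j\<^sub>i = \<sigma>\<^sub>j \<and> \<sigma>\<^sub>i\<close> with \<open>\<sigma>\<^sub>i \<in> f\<^sub>i\<close>, then both pairs span the same plane. It meets \<open>f\<^sub>i\<close> in
  the line through \<open>c\<close> only, because regularity of the lift forces \<open>w \<notin> f\<^sub>i\<close>; hence \<open>\<sigma>\<^sub>i = c / p\<close> and \<open>\<sigma>\<^sub>j = p w + k c\<close> for some \<open>p\<close> and
  \<open>k\<close>, and as \<open>f\<^sub>i\<close> is totally isotropic, \<open>(\<sigma>\<^sub>i, \<sigma>\<^sub>j) = (c, w)\<close> whatever the choice of \<open>\<sigma>\<close>. The value of
  \<open>(c, w)\<close> follows from \<open>(y\<^sub>i, w) = - |dx|\<^sup>2 / 2\<close> and \<open>(\<tt>\<^sub>i, w) = n\<^sub>i \<bullet> dx = |dx|\<^sup>2 / (2 r)\<close>; it is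
  \<open>- |dx|\<^sup>2 (r'/r + 1/r\<^sup>2) / 2\<close>, which is minus half the left-hand side of Eisenhart's formula, while
  \<open>2 / m\<^sub>i\<^sub>j = 2 (\<sigma>\<^sub>i, \<sigma>\<^sub>j)\<close>.

  Equations between bivectors are used through their contractions with linear functionals
  (\<open>contract_wedge\<close>), which turn them into equations between vectors.
\<close>

section \<open>Contraction of bivectors\<close>

lemma shuffle_sign_singletons:
  "shuffle_sign {a} {b} = (if b < a then - 1 else 1)"
proof -
  have "{(x, y). x \<in> {a} \<and> y \<in> {b} \<and> y < x} = (if b < a then {(a, b)} else {})"
    by auto
  then show ?thesis
    by (simp add: shuffle_sign_def)
qed

lemma wedge_ext_vec_nth:
  fixes u v :: "real ^ 'n::{finite,linorder}"
  assumes "a < b"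
  shows "(ext_vec u \<^bold>\<and> ext_vec v) $ {a, b} = u $ a * v $ b - u $ b * v $ a"
proof -
  have "Pow {a, b} = {{}, {a}, {b}, {a, b}}"
    by auto
  moreover have "{a, b} - {a} = {b}" "{a, b} - {b} = {a}" "\<not> is_singleton {a, b}"
    using assms by (auto simp: is_singleton_def)
  moreover have "\<not> is_singleton ({} :: 'n set)"
    by (simp add: is_singleton_def)
  moreover have "{a} \<noteq> {b}" "{a} \<noteq> {a, b}" "{b} \<noteq> {a, b}"
    using assms by auto
  ultimately show ?thesis
    using assms by (simp add: wedge_def ext_vec_def shuffle_sign_singletons)
qed

text \<open>
  The interior product of a functional with a bivector. The components of a bivector are stored for
  increasing index pairs only, so that the component at \<open>(a, b)\<close> with \<open>b < a\<close> is recovered from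
  antisymmetry.
\<close>

definition contract ::
    "(real ^ 'n::{finite,linorder} \<Rightarrow> real) \<Rightarrow> real ^ ('n set) \<Rightarrow> real ^ 'n::{finite,linorder}" where
  "contract \<phi> B = (\<chi> b. \<Sum>a\<in>UNIV. \<phi> (axis a 1) *
     (if a < b then B $ {a, b} else if b < a then - B $ {a, b} else 0))"

lemma contract_add: "contract \<phi> (A + B) = contract \<phi> A + contract \<phi> B"
proof -
  have "\<phi> (axis a 1) * (if a < b then (A + B) $ {a, b} else if b < a then - (A + B) $ {a, b} else 0)
    = \<phi> (axis a 1) * (if a < b then A $ {a, b} else if b < a then - A $ {a, b} else 0)
    + \<phi> (axis a 1) * (if a < b then B $ {a, b} else if b < a then - B $ {a, b} else 0)" for a b
    by (simp add: algebra_simps)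
  then show ?thesis
    by (simp add: contract_def vec_eq_iff sum.distrib)
qed

lemma linear_functional_expansion:
  fixes \<phi> :: "real ^ 'n::finite \<Rightarrow> real"
  assumes "linear \<phi>"
  shows "\<phi> u = (\<Sum>a\<in>UNIV. u $ a * \<phi> (axis a 1))"
proof -
  have "\<phi> u = \<phi> (\<Sum>a\<in>UNIV. u $ a *\<^sub>R axis a 1)"
    using basis_expansion[of u] by (simp add: scalar_mult_eq_scaleR)
  then show ?thesis
    by (simp add: linear_sum[OF assms] linear_cmul[OF assms])
qed

lemma contract_wedge:
  assumes "linear \<phi>"
  shows "contract \<phi> (ext_vec u \<^bold>\<and> ext_vec v) = \<phi> u *\<^sub>R v - \<phi> v *\<^sub>R u"
proof -
  have antisym: "(if a < b then (ext_vec u \<^bold>\<and> ext_vec v) $ {a, b}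
      else if b < a then - (ext_vec u \<^bold>\<and> ext_vec v) $ {a, b} else 0)
    = u $ a * v $ b - v $ a * u $ b" for a b
    using wedge_ext_vec_nth[of a b u v] wedge_ext_vec_nth[of b a u v]
    by (cases a b rule: linorder_cases) (auto simp: insert_commute)
  show ?thesis
    unfolding contract_def antisym linear_functional_expansion[OF assms, of u]
      linear_functional_expansion[OF assms, of v]
    by (simp add: vec_eq_iff sum_distrib_left sum_subtractf algebra_simps)
qed

section \<open>Decomposable bivectors and isotropic subspaces\<close>

lemma form42_commute: "form42 v w = form42 w v"
  by (simp add: form42_def)

lemma form42_linear:
  "form42 (u + v) w = form42 u w + form42 v w"
  "form42 (u - v) w = form42 u w - form42 v w"
  "form42 (k *\<^sub>R u) w = k * form42 u w"
  "form42 w (u + v) = form42 w u + form42 w v"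
  "form42 w (u - v) = form42 w u - form42 w v"
  "form42 w (k *\<^sub>R u) = k * form42 w u"
  by (simp_all add: form42_def algebra_simps)

text \<open>
  The contractions express that \<open>\<tau> \<and> \<sigma> = w \<and> c\<close>. A functional that vanishes on the isotropic space \<open>S\<close> but
  not on \<open>w\<close> makes \<open>c\<close> a multiple of \<open>\<sigma>\<close>; contraction with \<open>(\<cdot>, c)\<close>, which also annihilates \<open>S\<close>, then
  compares the two products.
\<close>

lemma form42_eq_of_contractions_eq:
  assumes "subspace S"
    and isotropic: "\<And>u v. u \<in> S \<Longrightarrow> v \<in> S \<Longrightarrow> form42 u v = 0"
    and "\<sigma> \<in> S" "c \<in> S" "c \<noteq> 0" "w \<notin> S"
    and contractions: "\<And>\<phi> :: real ^ 6 \<Rightarrow> real. linear \<phi> \<Longrightarrow>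
      \<phi> \<tau> *\<^sub>R \<sigma> - \<phi> \<sigma> *\<^sub>R \<tau> = \<phi> w *\<^sub>R c - \<phi> c *\<^sub>R w"
  shows "form42 \<sigma> \<tau> = form42 c w"
proof -
  obtain p z where p: "p \<in> span S" and z: "\<And>s. s \<in> span S \<Longrightarrow> orthogonal z s"
    and w: "w = p + z"
    using orthogonal_subspace_decomp_exists[of S w] by metis
  have "span S = S"
    using \<open>subspace S\<close> by (simp add: span_eq_iff)
  then have "z \<noteq> 0" and z_S: "\<And>s. s \<in> S \<Longrightarrow> z \<bullet> s = 0"
    using p z w \<open>w \<notin> S\<close> unfolding \<open>span S = S\<close> by (auto simp: orthogonal_def)
  have "z \<bullet> w = z \<bullet> z"
    using p z_S unfolding \<open>span S = S\<close> by (simp add: w inner_add_right)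
  define k where "k = (z \<bullet> \<tau>) / (z \<bullet> z)"
  have "linear (\<lambda>v. z \<bullet> v)"
    by (simp add: bounded_linear.linear bounded_linear_inner_right)
  from contractions[OF this] have "(z \<bullet> \<tau>) *\<^sub>R \<sigma> = (z \<bullet> z) *\<^sub>R c"
    using z_S \<open>\<sigma> \<in> S\<close> \<open>c \<in> S\<close> \<open>z \<bullet> w = z \<bullet> z\<close> by simp
  then have "(1 / (z \<bullet> z)) *\<^sub>R (z \<bullet> \<tau>) *\<^sub>R \<sigma> = (1 / (z \<bullet> z)) *\<^sub>R (z \<bullet> z) *\<^sub>R c"
    by simp
  then have c: "c = k *\<^sub>R \<sigma>"
    using \<open>z \<noteq> 0\<close> by (simp add: k_def)
  have "linear (\<lambda>v. form42 v c)"
    by (simp add: linear_iff form42_linear)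
  from contractions[OF this] have "form42 \<tau> c *\<^sub>R \<sigma> = form42 w c *\<^sub>R c"
    using isotropic \<open>\<sigma> \<in> S\<close> \<open>c \<in> S\<close> by simp
  then have "(form42 \<tau> \<sigma> - form42 w c) *\<^sub>R c = 0"
    using c by (metis (no_types) cancel_comm_monoid_add_class.diff_cancel form42_linear(6)
        mult.commute scaleR_left_diff_distrib scaleR_scaleR)
  then show ?thesis
    using \<open>c \<noteq> 0\<close> by (simp add: form42_commute)
qed

section \<open>The Legendre lift along an edge\<close>

lemma
  assumes "lie_frame \<pp> \<oo> \<qq> E"
  shows form42_point_lift_point_lift:
      "form42 (point_lift \<oo> \<qq> E x i) (point_lift \<oo> \<qq> E x j) = - ((x j - x i) \<bullet> (x j - x i)) / 2"
    and form42_plane_lift_point_lift: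
      "form42 (plane_lift \<pp> \<qq> E x n i) (point_lift \<oo> \<qq> E x j) = n i \<bullet> (x j - x i)"
    and form42_plane_lift_plane_lift:
      "form42 (plane_lift \<pp> \<qq> E x n i) (plane_lift \<pp> \<qq> E x n j) = n i \<bullet> n j - 1"
    and form42_plane_lift_frame:
      "form42 (plane_lift \<pp> \<qq> E x n i) \<pp> = - 1"
    and form42_point_lift_frame:
      "form42 (point_lift \<oo> \<qq> E x i) \<pp> = 0"
  using assms
  by (auto simp: lie_frame_def point_lift_def plane_lift_def form42_linear inner_diff
      form42_commute[of \<pp> "E v" for v] form42_commute[of \<oo> "E v" for v]
      form42_commute[of \<qq> "E v" for v] form42_commute[of \<pp> \<qq>] form42_commute[of \<pp> \<oo>]
      form42_commute[of \<qq> \<oo>] inner_commute field_simps)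

lemma legendre_lift_isotropic:
  assumes "lie_frame \<pp> \<oo> \<qq> E" "norm (n i) = 1"
    and "u \<in> legendre_lift \<pp> \<oo> \<qq> E x n i" "v \<in> legendre_lift \<pp> \<oo> \<qq> E x n i"
  shows "form42 u v = 0"
proof -
  have "n i \<bullet> n i = 1"
    using assms(2) by (simp add: dot_square_norm)
  then show ?thesis
    using assms(3,4)
    by (auto simp: legendre_lift_def span_insert span_empty form42_linear eq_diff_eq
        form42_point_lift_point_lift[OF assms(1)] form42_plane_lift_point_lift[OF assms(1)]
        form42_plane_lift_plane_lift[OF assms(1)]
        form42_commute[of "point_lift \<oo> \<qq> E x i" "plane_lift \<pp> \<qq> E x n i"] algebra_simps)
qed

text \<open>Both normals have unit length, and \<open>n\<^sub>j = n\<^sub>i - dx / r\<close>: expand \<open>|n\<^sub>j|\<^sup>2 = 1\<close>.\<close>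

lemma inner_normal_diff:
  fixes x n :: "'p \<Rightarrow> real ^ 3"
  assumes "norm (n i) = 1" "norm (n j) = 1" "r \<noteq> 0"
    and "diff_form x j i + r *\<^sub>R diff_form n j i = 0"
  shows "n i \<bullet> (x j - x i) = (x j - x i) \<bullet> (x j - x i) / (2 * r)"
proof -
  have dx: "x j - x i = r *\<^sub>R (n i - n j)"
    using assms(4) by (simp add: diff_form_def algebra_simps)
  have "n i \<bullet> n i = 1" "n j \<bullet> n j = 1"
    using assms(1,2) by (simp_all add: dot_square_norm)
  then show ?thesis
    using \<open>r \<noteq> 0\<close> unfolding dx
    by (simp add: inner_diff inner_commute field_simps)
qed

lemma point_lift_diff:
  assumes "linear E"
  shows "point_lift \<oo> \<qq> E x j - point_lift \<oo> \<qq> E x i =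
    E (diff_form x j i) + (((1/2) *\<^sub>R (x i + x j)) \<bullet> diff_form x j i) *\<^sub>R \<qq>"
proof -
  have "((1/2) *\<^sub>R (x i + x j)) \<bullet> diff_form x j i = (1/2) * (x j \<bullet> x j) - (1/2) * (x i \<bullet> x i)"
    by (simp add: diff_form_def inner_diff inner_add inner_commute algebra_simps)
  then show ?thesis
    by (simp only: point_lift_def diff_form_def linear_diff[OF assms]) (simp add: algebra_simps)
qed

text \<open>
  This says that \<open>y + r \<tt>\<close> takes the same value at both ends: it is the lift of the sphere of radius \<open>r\<close> in
  oriented contact with both contact elements.
\<close>

lemma plane_lift_diff:
  assumes "linear E" "norm (n i) = 1" "norm (n j) = 1" "r \<noteq> 0"
    and "diff_form x j i + r *\<^sub>R diff_form n j i = 0"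
  shows "plane_lift \<pp> \<qq> E x n j - plane_lift \<pp> \<qq> E x n i =
    (- 1 / r) *\<^sub>R (point_lift \<oo> \<qq> E x j - point_lift \<oo> \<qq> E x i)"
proof -
  have n: "n j = n i - (1 / r) *\<^sub>R (x j - x i)"
  proof -
    have "r *\<^sub>R (n j - n i) = - (x j - x i)"
      using assms(5) by (simp add: diff_form_def algebra_simps add_eq_0_iff)
    then have "(1 / r) *\<^sub>R r *\<^sub>R (n j - n i) = (1 / r) *\<^sub>R (- (x j - x i))"
      by simp
    then show ?thesis
      using \<open>r \<noteq> 0\<close> by (simp add: algebra_simps)
  qed
  have "x j \<bullet> n j - x i \<bullet> n i = n i \<bullet> (x j - x i) - (1 / r) * (x j \<bullet> (x j - x i))"
    by (simp add: n inner_diff inner_commute)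
  also have "\<dots> = (- 1 / r) * ((1/2) * (x j \<bullet> x j) - (1/2) * (x i \<bullet> x i))"
    unfolding inner_normal_diff[OF assms(2-5)] using \<open>r \<noteq> 0\<close>
    by (simp add: inner_diff inner_commute field_simps)
  finally have q: "x j \<bullet> n j = x i \<bullet> n i + (- 1 / r) * ((1/2) * (x j \<bullet> x j) - (1/2) * (x i \<bullet> x i))"
    by simp
  have "E (n j) = E (n i) + (- 1 / r) *\<^sub>R (E (x j) - E (x i))"
    unfolding n by (simp add: linear_diff[OF assms(1)] linear_cmul[OF assms(1)])
  then show ?thesis
    unfolding plane_lift_def point_lift_def q
    by (simp add: algebra_simps)
qed

text \<open>
  Otherwise both lifts at \<open>j\<close> would lie in \<open>f\<^sub>i\<close>, so that \<open>f\<^sub>j \<subseteq> f\<^sub>i\<close> and the span of the two would have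
  dimension at most two.
\<close>

lemma point_lift_diff_notin_legendre_lift:
  assumes dim: "dim (edge_span (legendre_lift \<pp> \<oo> \<qq> E x n) i j) = 3"
    and t: "plane_lift \<pp> \<qq> E x n j - plane_lift \<pp> \<qq> E x n i =
      k *\<^sub>R (point_lift \<oo> \<qq> E x j - point_lift \<oo> \<qq> E x i)"
  shows "point_lift \<oo> \<qq> E x j - point_lift \<oo> \<qq> E x i \<notin> legendre_lift \<pp> \<oo> \<qq> E x n i"
proof
  let ?y = "point_lift \<oo> \<qq> E x" and ?t = "plane_lift \<pp> \<qq> E x n"
  let ?f = "legendre_lift \<pp> \<oo> \<qq> E x n"
  assume w: "?y j - ?y i \<in> ?f i"
  have sub: "subspace (?f i)" and mem: "?y i \<in> ?f i" "?t i \<in> ?f i"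
    by (simp_all add: legendre_lift_def span_base)
  have "?y i + (?y j - ?y i) \<in> ?f i" "?t i + k *\<^sub>R (?y j - ?y i) \<in> ?f i"
    using sub mem w by (blast intro: subspace_add subspace_scale)+
  then have "?y j \<in> ?f i" "?t j \<in> ?f i"
    unfolding t[symmetric] by simp_all
  then have "?f j \<subseteq> ?f i"
    unfolding legendre_lift_def[of _ _ _ _ _ _ j] using sub by (simp add: span_minimal)
  then have "edge_span ?f i j \<subseteq> ?f i"
    using sub by (auto simp: edge_span_def intro: subspace_add)
  then have "dim (edge_span ?f i j) \<le> dim {?y i, ?t i}"
    unfolding legendre_lift_def[of _ _ _ _ _ _ i] by (metis dim_span dim_subset)
  also have "\<dots> \<le> card {?y i, ?t i}"
    by (simp add: dim_le_card')
  also have "\<dots> \<le> 2"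
    by (simp add: card_insert_if)
  finally show False
    using dim by simp
qed

section \<open>Collapse of the closed form to a decomposable bivector\<close>

text \<open>
  The right-hand side is the contraction of \<open>w \<and> c\<close>. The first factors of \<open>\<eta>\<^sub>j\<^sub>i\<close> are \<open>(r'/r) w\<close> and
  \<open>- w / r\<close>; the midpoints \<open>y\<^sub>i + w/2\<close> and \<open>\<tt>\<^sub>i - w/(2 r)\<close> may be replaced by \<open>y\<^sub>i\<close> and \<open>\<tt>\<^sub>i\<close>, since \<open>w \<and> w = 0\<close>.
\<close>

lemma contract_omega_form:
  fixes x n x' :: "'p \<Rightarrow> real ^ 3" and \<pp> \<oo> \<qq> :: "real ^ 6"
  assumes "linear E" "norm (n i) = 1" "norm (n j) = 1" "r \<noteq> 0"
    and dx: "diff_form x j i + r *\<^sub>R diff_form n j i = 0"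
    and dx': "diff_form x' j i + r' *\<^sub>R diff_form n j i = 0"
    and "linear \<phi>"
  defines "w \<equiv> point_lift \<oo> \<qq> E x j - point_lift \<oo> \<qq> E x i"
    and "c \<equiv> (r' / r) *\<^sub>R point_lift \<oo> \<qq> E x i - (1 / r) *\<^sub>R plane_lift \<pp> \<qq> E x n i"
  shows "contract \<phi> (omega_form \<pp> \<oo> \<qq> E x n x' j i) = \<phi> w *\<^sub>R c - \<phi> c *\<^sub>R w"
proof -
  define y where "y = point_lift \<oo> \<qq> E x i"
  define t where "t = plane_lift \<pp> \<qq> E x n i"
  have proportional: "E (k *\<^sub>R diff_form x j i) +
      (((1/2) *\<^sub>R (x i + x j)) \<bullet> (k *\<^sub>R diff_form x j i)) *\<^sub>R \<qq> = k *\<^sub>R w" for k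
    unfolding w_def point_lift_diff[OF assms(1)]
    by (simp add: linear_cmul[OF assms(1)] scaleR_add_right)
  have dn: "diff_form n j i = (- 1 / r) *\<^sub>R diff_form x j i"
  proof -
    have "diff_form x j i = (- r) *\<^sub>R diff_form n j i"
      using dx by (simp add: eq_neg_iff_add_eq_0)
    then show ?thesis
      using \<open>r \<noteq> 0\<close> by simp
  qed
  have "diff_form x' j i = (- r') *\<^sub>R diff_form n j i"
    using dx' by (simp add: eq_neg_iff_add_eq_0)
  then have dx'_dx: "diff_form x' j i = (r' / r) *\<^sub>R diff_form x j i"
    by (simp add: dn)
  have midpoint: "(1/2) *\<^sub>R (a + (a + b)) = a + (1/2) *\<^sub>R b" for a b :: "real ^ 6"
    by (simp add: vec_eq_iff)
  have "point_lift \<oo> \<qq> E x j = y + w"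
    by (simp add: y_def w_def)
  moreover have "plane_lift \<pp> \<qq> E x n j = t + (- 1 / r) *\<^sub>R w"
    using plane_lift_diff[OF assms(1-4) dx, of \<pp> \<qq> \<oo>] by (simp add: t_def w_def algebra_simps)
  ultimately have factored: "omega_form \<pp> \<oo> \<qq> E x n x' j i =
      ext_vec ((r' / r) *\<^sub>R w) \<^bold>\<and> ext_vec (y + (1/2) *\<^sub>R w) +
      ext_vec ((- 1 / r) *\<^sub>R w) \<^bold>\<and> ext_vec (t + (1/2) *\<^sub>R (- 1 / r) *\<^sub>R w)"
    unfolding omega_form_def dx'_dx dn proportional
    by (simp only: midpoint y_def[symmetric] t_def[symmetric])
  show ?thesis
    unfolding factored c_def y_def[symmetric] t_def[symmetric]
    by (simp add: contract_add contract_wedge[OF \<open>linear \<phi>\<close>] linear_add[OF \<open>linear \<phi>\<close>]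
        linear_diff[OF \<open>linear \<phi>\<close>] linear_cmul[OF \<open>linear \<phi>\<close>] linear_neg[OF \<open>linear \<phi>\<close>]
        vec_eq_iff algebra_simps add_divide_distrib diff_divide_distrib)
qed

lemma form42_omega_factors:
  fixes x n x' :: "'p \<Rightarrow> real ^ 3"
  assumes frame: "lie_frame \<pp> \<oo> \<qq> E"
    and unit: "norm (n i) = 1" "norm (n j) = 1"
    and r: "r \<noteq> 0" "diff_form x j i + r *\<^sub>R diff_form n j i = 0"
    and r': "diff_form x' j i + r' *\<^sub>R diff_form n j i = 0"
    and dim: "dim (edge_span (legendre_lift \<pp> \<oo> \<qq> E x n) i j) = 3"
    and \<sigma>: "\<sigma> \<in> legendre_lift \<pp> \<oo> \<qq> E x n i"
    and \<eta>: "omega_form \<pp> \<oo> \<qq> E x n x' j i = ext_vec \<tau> \<^bold>\<and> ext_vec \<sigma>"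
  shows "form42 \<sigma> \<tau> = - ((x j - x i) \<bullet> (x j - x i)) * (r' / r + 1 / r\<^sup>2) / 2"
proof -
  let ?y = "point_lift \<oo> \<qq> E x" and ?t = "plane_lift \<pp> \<qq> E x n"
  let ?f = "legendre_lift \<pp> \<oo> \<qq> E x n"
  define w where "w = ?y j - ?y i"
  define c where "c = (r' / r) *\<^sub>R ?y i - (1 / r) *\<^sub>R ?t i"
  have "linear E"
    using frame by (simp add: lie_frame_def)
  have "c \<in> ?f i"
    by (simp add: c_def legendre_lift_def span_base span_diff span_scale)
  moreover have "c \<noteq> 0"
  proof
    \<comment> \<open>The \<open>\<pp>\<close>-component of \<open>c\<close> comes from \<open>\<tt>\<^sub>i\<close> alone.\<close>
    have "form42 c \<pp> = 1 / r"
      by (simp add: c_def form42_linear form42_plane_lift_frame[OF frame]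
          form42_point_lift_frame[OF frame])
    moreover assume "c = 0"
    ultimately show False
      using r(1) by (simp add: form42_def)
  qed
  moreover have "w \<notin> ?f i"
    unfolding w_def
    using point_lift_diff_notin_legendre_lift[OF dim plane_lift_diff[OF \<open>linear E\<close> unit r]] .
  moreover have "\<phi> \<tau> *\<^sub>R \<sigma> - \<phi> \<sigma> *\<^sub>R \<tau> = \<phi> w *\<^sub>R c - \<phi> c *\<^sub>R w" if "linear \<phi>" for \<phi>
    using contract_omega_form[OF \<open>linear E\<close> unit r r' that, of \<pp> \<oo> \<qq>]
    unfolding \<eta> contract_wedge[OF that] w_def c_def .
  moreover have "subspace (?f i)"
    by (simp add: legendre_lift_def)
  ultimately have "form42 \<sigma> \<tau> = form42 c w"
    using form42_eq_of_contractions_eq[of "?f i" \<sigma> c w \<tau>] \<sigma>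
      legendre_lift_isotropic[where n = n and i = i, OF frame unit(1)] by blast
  also have "\<dots> = (r' / r) * (- ((x j - x i) \<bullet> (x j - x i)) / 2) - (1 / r) * (n i \<bullet> (x j - x i))"
    by (simp add: c_def w_def form42_linear form42_point_lift_point_lift[OF frame]
        form42_plane_lift_point_lift[OF frame])
  also have "\<dots> = - ((x j - x i) \<bullet> (x j - x i)) * (r' / r + 1 / r\<^sup>2) / 2"
    unfolding inner_normal_diff[OF unit r] using r(1)
    by (simp add: field_simps power2_eq_square)
  finally show ?thesis .
qed

section \<open>Eisenhart's formula\<close>

lemma collinear_common_unit_vector:
  fixes a b :: "'a::euclidean_space"
  assumes "collinear {0, a, b}"
  shows "\<exists>u s t. norm u = 1 \<and> a = s *\<^sub>R u \<and> b = t *\<^sub>R u"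
proof -
  have unit: "\<exists>u s. norm u = 1 \<and> v = s *\<^sub>R u" for v :: 'a
  proof (cases "v = 0")
    case True
    then show ?thesis
      using vector_choose_size[of 1, where 'a = 'a] by (metis scaleR_zero_left zero_le_one)
  next
    case False
    then show ?thesis
      by (intro exI[of _ "sgn v"] exI[of _ "norm v"]) (simp add: norm_sgn sgn_div_norm)
  qed
  consider "a = 0" | "b = 0" | k where "b = k *\<^sub>R a"
    using assms unfolding collinear_lemma by blast
  then show ?thesis
  proof cases
    case 1
    then show ?thesis
      using unit[of b] by (metis scaleR_zero_left)
  next
    case 2
    then show ?thesis
      using unit[of a] by (metis scaleR_zero_left)
  next
    case 3
    then show ?thesis
      using unit[of a] by (metis scaleR_scaleR)
  qed
qed

theorem corollary7p3:
  fixes \<Sigma> :: "(int ^ 'N::finite) set"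
    and x n x' :: "int ^ 'N \<Rightarrow> real ^ 3"
    and \<pp> \<oo> \<qq> :: "real ^ 6"
    and E :: "real ^ 3 \<Rightarrow> real ^ 6"
    and m :: "int ^ 'N \<Rightarrow> int ^ 'N \<Rightarrow> ereal"
  assumes "lie_frame \<pp> \<oo> \<qq> E"
    and "guichard_net \<Sigma> x n"
    and "associate_net \<Sigma> x n x'"
    and "regular_lift \<Sigma> (legendre_lift \<pp> \<oo> \<qq> E x n)"
    and "nondegenerate_form \<Sigma> (legendre_lift \<pp> \<oo> \<qq> E x n) (omega_form \<pp> \<oo> \<qq> E x n x')"
    and "edge_labelling \<Sigma> (legendre_lift \<pp> \<oo> \<qq> E x n) (omega_form \<pp> \<oo> \<qq> E x n x') m"
    and "edge \<Sigma> i j"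
  shows "(\<exists>u d d'. norm u = 1 \<and> x j - x i = d *\<^sub>R u \<and> x' j - x' i = d' *\<^sub>R u) \<and>
         (\<forall>u d d' r r'.
            norm u = 1 \<longrightarrow> x j - x i = d *\<^sub>R u \<longrightarrow> x' j - x' i = d' *\<^sub>R u \<longrightarrow>
            r \<noteq> 0 \<longrightarrow> r' \<noteq> 0 \<longrightarrow>
            diff_form x j i + r *\<^sub>R diff_form n j i = 0 \<longrightarrow>
            diff_form x' j i + r' *\<^sub>R diff_form n j i = 0 \<longrightarrow>
            ereal (d * d' * (1 + 1 / (r * r'))) = - (2 / m i j))"
proof (intro conjI allI impI)
  have "collinear {0, diff_form x' j i, diff_form x j i}"
    using assms(3,7) by (simp add: associate_net_def edge_parallel_def)
  then show "\<exists>u d d'. norm u = 1 \<and> x j - x i = d *\<^sub>R u \<and> x' j - x' i = d' *\<^sub>R u"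
    using collinear_common_unit_vector unfolding diff_form_def by metis
next
  fix u d d' r r'
  assume u: "norm u = 1" and d: "x j - x i = d *\<^sub>R u" and d': "x' j - x' i = d' *\<^sub>R u"
    and r: "r \<noteq> 0" "diff_form x j i + r *\<^sub>R diff_form n j i = 0"
    and r': "r' \<noteq> 0" "diff_form x' j i + r' *\<^sub>R diff_form n j i = 0"
  have unit: "norm (n i) = 1" "norm (n j) = 1"
    using assms(2,7) by (auto simp: guichard_net_def principal_net_def edge_def)
  have dim: "dim (edge_span (legendre_lift \<pp> \<oo> \<qq> E x n) i j) = 3"
    using assms(4,7) by (simp add: regular_lift_def)
  obtain \<sigma> \<tau> where \<sigma>: "\<sigma> \<in> legendre_lift \<pp> \<oo> \<qq> E x n i"
    and \<eta>: "omega_form \<pp> \<oo> \<qq> E x n x' j i = ext_vec \<tau> \<^bold>\<and> ext_vec \<sigma>"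
    and m: "m i j = 1 / ereal (form42 \<sigma> \<tau>)"
    using assms(6,7) unfolding edge_labelling_def by blast
  have "u \<bullet> u = 1"
    using u by (simp add: dot_square_norm)
  have "(r * d') *\<^sub>R u = (r' * d) *\<^sub>R u"
  proof -
    have "d *\<^sub>R u = - (r *\<^sub>R diff_form n j i)" "d' *\<^sub>R u = - (r' *\<^sub>R diff_form n j i)"
      using r(2) r'(2) d d' by (simp_all add: diff_form_def eq_neg_iff_add_eq_0)
    then have "r *\<^sub>R d' *\<^sub>R u = r' *\<^sub>R d *\<^sub>R u"
      by (simp add: mult.commute)
    then show ?thesis
      by simp
  qed
  then have "d' = r' * d / r"
    using u r(1) by (auto simp: field_simps)
  then have "d * d' * (1 + 1 / (r * r')) = d\<^sup>2 * (r' / r + 1 / r\<^sup>2)"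
    unfolding \<open>d' = r' * d / r\<close> using r(1) r'(1) by (simp add: field_simps power2_eq_square)
  also have "\<dots> = - (2 * form42 \<sigma> \<tau>)"
    unfolding form42_omega_factors[OF assms(1) unit r r'(2) dim \<sigma> \<eta>] d
    using \<open>u \<bullet> u = 1\<close> by (simp add: power2_eq_square)
  finally have "d * d' * (1 + 1 / (r * r')) = - (2 * form42 \<sigma> \<tau>)" .
  moreover have "2 / m i j = ereal (2 * form42 \<sigma> \<tau>)"
    \<comment> \<open>For a vanishing product the label is \<open>\<infinity>\<close>, and both sides are \<open>0\<close>.\<close>
    unfolding m by (cases "form42 \<sigma> \<tau> = 0") (simp_all add: one_ereal_def divide_ereal_def)
  ultimately show "ereal (d * d' * (1 + 1 / (r * r'))) = - (2 / m i j)"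
    by simp
qed

end
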